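(* Let $m>1$ and $n\in\mathbb N_0$, and write $n=a_0+a_1m+\dots+a_sm^s$ with $1\le a_j\le m-1$ for $j=0,\dots,s$. Then $$\overline{b}_m(mn)\equiv\prod_{i=0}^{s}(2a_i+1)+2m\Bigg(\sum_{i=1}^{s}a_i^2\prod_{\substack{j=0\\ j\ne i,\,i-1}}^{s}(2a_j+1)\Bigg)\pmod{m^2}.$$
   Context: The sequence $(\overline{b}_m(n))_{n\in\mathbb N_0}$ is defined by $\overline{b}_m(0)=1$, $\overline{b}_m(mn)=\overline{b}_m(mn+1)=\dots=\overline{b}_m(mn+m-1)$ for $n\ge0$, and $\overline{b}_m(mn)-\overline{b}_m(mn-1)=\overline{b}_m(n)+\overline{b}_m(n-1)$ for $n\ge1$. Empty sums are $0$ and empty products are $1$. *)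

theory Defs
  imports Main "HOL-Number_Theory.Cong"
begin

text \<open>
  The recursion below only descends for \<open>m > 1\<close>; for \<open>m \<le> 1\<close> the conditions defining the
  sequence are degenerate and the value is a dummy.  The first branch combines the two clauses
  for \<open>k = 0\<close> and for \<open>k\<close> not divisible by \<open>m\<close> (constancy on blocks of length \<open>m\<close>); the last one is
  the difference equation with \<open>b(k - 1)\<close> moved to the right-hand side, so that no truncated
  subtraction of sequence values occurs.
\<close>

function bbar :: "nat \<Rightarrow> nat \<Rightarrow> nat" where
  "bbar m k =
     (if m \<le> 1 \<or> k = 0 then 1
      else if k mod m \<noteq> 0 then bbar m (k - 1)
      else bbar m (k - 1) + bbar m (k div m) + bbar m (k div m - 1))"
  by auto
termination
  by (relation "measure snd") (auto simp: div_less_dividend less_imp_diff_less)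

declare bbar.simps [simp del]

lemma bbar_0: "bbar m 0 = 1"
  by (simp add: bbar.simps)

lemma bbar_block:
  assumes "m > 1" and "i < m"
  shows "bbar m (m * n + i) = bbar m (m * n)"
  using assms(2)
proof (induction i)
  case (Suc i)
  have "(m * n + Suc i) mod m = Suc i"
    using Suc.prems by simp
  then show ?case
    using assms(1) Suc by (subst bbar.simps) simp
qed simp

lemma bbar_diff:
  assumes "m > 1" and "n \<ge> 1"
  shows "int (bbar m (m * n)) - int (bbar m (m * n - 1)) = int (bbar m n) + int (bbar m (n - 1))"
  using assms by (subst bbar.simps) simp

lemma bbar_unique:
  fixes b :: "nat \<Rightarrow> int"
  assumes m: "m > 1"
    and zero: "b 0 = 1"
    and block: "\<And>n i. i < m \<Longrightarrow> b (m * n + i) = b (m * n)"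
    and diff: "\<And>n. n \<ge> 1 \<Longrightarrow> b (m * n) - b (m * n - 1) = b n + b (n - 1)"
  shows "b k = int (bbar m k)"
proof (induction k rule: less_induct)
  case (less k)
  define q r where "q = k div m" and "r = k mod m"
  have k: "k = m * q + r" and r: "r < m"
    using m by (simp_all add: q_def r_def)
  show ?case
  proof (cases "r = 0")
    case False
    then have "m * q < k"
      using k by simp
    then show ?thesis
      using less.IH[of "m * q"] block[OF r, of q] bbar_block[OF m r, of q] k by simp
  next
    case True
    show ?thesis
    proof (cases "q = 0")
      case True
      then show ?thesis
        using \<open>r = 0\<close> k zero by (simp add: bbar_0)
    next
      case False
      then have q: "q \<ge> 1" and "q < k"
        using k m \<open>r = 0\<close> by simp_all
      moreover have "q - 1 < k"
        using \<open>q < k\<close> by simp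
      ultimately show ?thesis
        using diff[OF q] bbar_diff[OF m q] less.IH[of q] less.IH[of "q - 1"] less.IH[of "k - 1"]
          k \<open>r = 0\<close> by simp
    qed
  qed
qed

end

theory Submission
  imports Defs
begin

text \<open>
  Put \<open>B n = bbar m (m * n)\<close>.  Summing the difference equation gives
  \<open>B (m q + r) = 2 m (B 0 + \<dots> + B (q - 1)) + (2 r + 1) B q\<close> for \<open>r < m\<close>.  In particular
  \<open>B (m q + r) \<equiv> (2 r + 1) B q\<close> modulo \<open>m\<close>.  As \<open>1 + 3 + \<dots> + (2 c - 1) = c\<^sup>2\<close>, full blocks
  of length \<open>m\<close> in \<open>B 0 + \<dots> + B (m p + c - 1)\<close> vanish modulo \<open>m\<close> and the last, partial one
  contributes \<open>c\<^sup>2 B p\<close>.  Hence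
  \<open>B (m (m p + c) + r) \<equiv> (2 r + 1) B (m p + c) + 2 m c\<^sup>2 B p\<close> modulo \<open>m\<^sup>2\<close>, which is the
  recursion of the right-hand side in the number of digits.
\<close>

lemma sum_lessThan_add:
  fixes f :: "nat \<Rightarrow> 'a :: comm_monoid_add"
  shows "sum f {..<a + b} = sum f {..<a} + (\<Sum>i<b. f (a + i))"
  by (induction b) (simp_all add: add.assoc)

lemma sum_lessThan_mult_add:
  fixes f :: "nat \<Rightarrow> 'a :: comm_monoid_add"
  shows "sum f {..<m * q + r} = (\<Sum>j<q. \<Sum>i<m. f (m * j + i)) + (\<Sum>i<r. f (m * q + i))"
proof -
  have "sum f {..<m * q} = (\<Sum>j<q. \<Sum>i<m. f (m * j + i))"
    by (induction q) (simp_all add: sum_lessThan_add add.commute[of m])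
  then show ?thesis
    by (simp add: sum_lessThan_add)
qed

lemma sum_odd_eq_square: "(\<Sum>i<n. 2 * i + 1) = (n::nat)\<^sup>2"
  by (induction n) (simp_all add: power2_eq_square)

text \<open>Constancy on blocks makes the value just before \<open>m * Suc n\<close> equal to the
  one at \<open>m * n\<close>, so the difference equation telescopes. The missing second copy of
  \<open>bbar m 0\<close> is supplied by the initial value 1.\<close>

lemma bbar_mult_eq_sum:
  assumes "m > 1"
  shows "bbar m (m * n) = 2 * (\<Sum>k<n. bbar m k) + bbar m n"
proof (induction n)
  case (Suc n)
  have "m * Suc n - 1 = m * n + (m - 1)"
    using assms by simp
  then have "bbar m (m * Suc n - 1) = bbar m (m * n)"
    using bbar_block[OF assms, of "m - 1" n] assms by simp
  then have "bbar m (m * Suc n) = bbar m (m * n) + bbar m (Suc n) + bbar m n"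
    using bbar_diff[OF assms, of "Suc n"] by simp
  then show ?case
    using Suc.IH by simp
qed (simp add: bbar_0)

text \<open>Each of the \<open>q\<close> full blocks below \<open>m * q + r\<close> has
  \<open>m\<close> equal terms. The \<open>r\<close> leftover terms, counted twice, and the final
  \<open>bbar m (m * q + r)\<close> all equal \<open>bbar m (m * q)\<close>, whence the odd
  factor.\<close>

lemma bbar_mult_digit:
  assumes "m > 1" "r < m"
  shows "bbar m (m * (m * q + r)) =
    2 * m * (\<Sum>j<q. bbar m (m * j)) + (2 * r + 1) * bbar m (m * q)"
proof -
  have "(\<Sum>k<m * q + r. bbar m k) = m * (\<Sum>j<q. bbar m (m * j)) + r * bbar m (m * q)"
    using assms by (simp add: sum_lessThan_mult_add bbar_block sum_distrib_left)
  moreover have "bbar m (m * (m * q + r)) = 2 * (\<Sum>k<m * q + r. bbar m k) + bbar m (m * q)"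
    using assms by (simp only: bbar_mult_eq_sum[of m "m * q + r"] bbar_block)
  ultimately show ?thesis
    by (simp only:) (simp add: algebra_simps)
qed

lemma bbar_mult_digit_cong:
  assumes "m > 1" "r < m"
  shows "[bbar m (m * (m * q + r)) = (2 * r + 1) * bbar m (m * q)] (mod m)"
  by (simp add: bbar_mult_digit[OF assms] cong_def mult.assoc mult.left_commute[of 2 m])

lemma sum_bbar_mult_cong:
  assumes "m > 1" "c < m"
  shows "[(\<Sum>j<m * p + c. bbar m (m * j)) = c\<^sup>2 * bbar m (m * p)] (mod m)"
proof -
  \<comment> \<open>Allowing \<open>k = m\<close> covers full blocks, which vanish because of the
    factor \<open>m\<^sup>2\<close>; \<open>k = c\<close> gives the partial block.\<close>
  have block: "[(\<Sum>i<k. bbar m (m * (m * q + i))) = k\<^sup>2 * bbar m (m * q)] (mod m)"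
    if "k \<le> m" for k q
  proof -
    have "[(\<Sum>i<k. bbar m (m * (m * q + i))) = (\<Sum>i<k. (2 * i + 1) * bbar m (m * q))] (mod m)"
      using that assms(1) by (intro cong_sum bbar_mult_digit_cong) auto
    then show ?thesis
      by (simp only: flip: sum_distrib_right sum_odd_eq_square)
  qed
  have "[(\<Sum>i<m. bbar m (m * (m * q + i))) = 0] (mod m)" for q
    using block[of m q] by (simp add: cong_def power2_eq_square mult.assoc)
  then have "[(\<Sum>q<p. \<Sum>i<m. bbar m (m * (m * q + i))) = (\<Sum>q<p. 0)] (mod m)"
    by (intro cong_sum)
  from cong_add[OF this block[of c p]] show ?thesis
    using assms(2) by (simp add: sum_lessThan_mult_add)
qed

lemma bbar_mult_two_digits_cong:
  assumes "m > 1" "r < m" "c < m"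
  shows "[bbar m (m * (m * (m * p + c) + r)) =
    (2 * r + 1) * bbar m (m * (m * p + c)) + 2 * m * (c\<^sup>2 * bbar m (m * p))] (mod m\<^sup>2)"
proof -
  \<comment> \<open>The prefactor \<open>m\<close> lifts a congruence modulo \<open>m\<close> to one
    modulo \<open>m\<^sup>2\<close>.\<close>
  have "[m * (\<Sum>j<m * p + c. bbar m (m * j)) = m * (c\<^sup>2 * bbar m (m * p))] (mod m * m)"
    using sum_bbar_mult_cong[OF assms(1,3)] by (rule cong_cmult_leftI)
  from cong_add[OF cong_refl cong_scalar_left[OF this, of 2]] show ?thesis
    unfolding bbar_mult_digit[OF assms(1,2)] power2_eq_square[of m]
    by (subst add.commute) (simp only: mult.assoc)
qed

lemma sum_digits_shift:
  fixes a :: "nat \<Rightarrow> nat"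
  shows "(\<Sum>j<Suc s. a j * m ^ j) = m * (\<Sum>j<s. a (Suc j) * m ^ j) + a 0"
  by (simp add: sum.lessThan_Suc_shift sum_distrib_left algebra_simps del: sum.lessThan_Suc)

text \<open>Peels off the lowest digit repeatedly. The strict bound on \<open>j\<close> admits the
  empty digit string, which is what remains when two digits are removed from a two-digit
  number.\<close>

lemma bbar_mult_cong_prod:
  assumes "m > 1" "\<And>j. j < s \<Longrightarrow> a j < m"
  shows "[bbar m (m * (\<Sum>j<s. a j * m ^ j)) = (\<Prod>j<s. 2 * a j + 1)] (mod m)"
  using assms(2)
proof (induction s arbitrary: a)
  case (Suc s)
  have "[bbar m (m * (\<Sum>j<s. a (Suc j) * m ^ j)) = (\<Prod>j<s. 2 * a (Suc j) + 1)] (mod m)"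
    using Suc by simp
  from cong_trans[OF bbar_mult_digit_cong cong_scalar_left[OF this]] show ?case
    using assms(1) Suc.prems[of 0]
    by (simp add: sum_digits_shift prod.lessThan_Suc_shift
        del: sum.lessThan_Suc prod.lessThan_Suc mult_Suc)
qed (simp add: bbar_0)

text \<open>Matches the two-digit recursion: for \<open>i = 1\<close> the deleted indices are 0 and
  1, so only later factors remain; for larger \<open>i\<close> index 0 survives and
  \<open>f 0\<close> factors out.\<close>

lemma sum_prod_adjacent_shift:
  fixes f g :: "nat \<Rightarrow> 'a :: comm_semiring_1"
  shows "(\<Sum>i=1..Suc s. g i * (\<Prod>j\<in>{0..Suc s} - {i, i - 1}. f j)) =
    g 1 * (\<Prod>j<s. f (Suc (Suc j))) +
    f 0 * (\<Sum>i=1..s. g (Suc i) * (\<Prod>j\<in>{0..s} - {i, i - 1}. f (Suc j)))"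
proof -
  have "{0..Suc s} - {1, 0} = (Suc \<circ> Suc) ` {..<s}"
  proof (intro equalityI subsetI)
    fix x assume "x \<in> {0..Suc s} - {1, 0}"
    then have "x = (Suc \<circ> Suc) (x - 2)" "x - 2 < s" by auto
    then show "x \<in> (Suc \<circ> Suc) ` {..<s}" by blast
  qed auto
  then have first: "(\<Prod>j\<in>{0..Suc s} - {1, 0}. f j) = (\<Prod>j<s. f (Suc (Suc j)))"
    by (simp add: prod.reindex inj_on_def del: image_comp)
  \<comment> \<open>For \<open>i = 0\<close> truncated subtraction would break the shift, and index
    0 would be deleted on the left.\<close>
  have later: "(\<Prod>j\<in>{0..Suc s} - {Suc i, i}. f j) = f 0 * (\<Prod>j\<in>{0..s} - {i, i - 1}. f (Suc j))"
    if "i \<ge> 1" for i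
  proof -
    have "{0..Suc s} - {Suc i, i} = insert 0 (Suc ` ({0..s} - {i, i - 1}))"
    proof (intro equalityI subsetI)
      fix x assume "x \<in> {0..Suc s} - {Suc i, i}"
      then show "x \<in> insert 0 (Suc ` ({0..s} - {i, i - 1}))"
        by (cases x) auto
    qed (use that in auto)
    then show ?thesis
      by (simp add: prod.reindex)
  qed
  have "(\<Sum>i=1..Suc s. g i * (\<Prod>j\<in>{0..Suc s} - {i, i - 1}. f j)) =
    g 1 * (\<Prod>j\<in>{0..Suc s} - {1, 0}. f j) +
    (\<Sum>i=1..s. g (Suc i) * (\<Prod>j\<in>{0..Suc s} - {Suc i, i}. f j))"
    by (subst sum.atLeast_Suc_atMost, simp, subst sum.atLeast_Suc_atMost_Suc_shift) simp
  also have "\<dots> = g 1 * (\<Prod>j<s. f (Suc (Suc j))) +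
    (\<Sum>i=1..s. f 0 * (g (Suc i) * (\<Prod>j\<in>{0..s} - {i, i - 1}. f (Suc j))))"
    unfolding first by (intro arg_cong2[of _ _ _ _ "(+)"] sum.cong) (simp_all add: later mult_ac)
  finally show ?thesis
    by (simp add: sum_distrib_left)
qed

theorem theorem13:
  fixes m n s :: nat and a :: "nat \<Rightarrow> nat"
  assumes "m > 1"
    and "n = (\<Sum>j=0..s. a j * m ^ j)"
    and "\<And>j. j \<le> s \<Longrightarrow> 1 \<le> a j \<and> a j \<le> m - 1"
  shows "[bbar m (m * n) =
           (\<Prod>i=0..s. (2 * a i + 1))
           + 2 * m * (\<Sum>i=1..s. (a i)\<^sup>2 * (\<Prod>j\<in>{0..s} - {i, i - 1}. (2 * a j + 1)))] (mod m\<^sup>2)"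
proof -
  have "a j < m" if "j \<le> s" for j
    using assms(1) assms(3)[OF that] by linarith
  then show ?thesis
    unfolding assms(2)
  proof (induction s arbitrary: a)
    case 0
    then show ?case
      using bbar_mult_digit[OF assms(1), of "a 0" 0] by (simp add: bbar_0)
  next
    case (Suc s)
    \<comment> \<open>\<open>R\<close> is the claimed value once the digit \<open>a 0\<close> is
      dropped; \<open>p\<close> is the number left after dropping \<open>a 1\<close> as well, and
      \<open>P\<close> its digit product.\<close>
    define R where "R = (\<Prod>i=0..s. 2 * a (Suc i) + 1) + 2 * m *
      (\<Sum>i=1..s. (a (Suc i))\<^sup>2 * (\<Prod>j\<in>{0..s} - {i, i - 1}. 2 * a (Suc j) + 1))"
    define p where "p = (\<Sum>j<s. a (Suc (Suc j)) * m ^ j)"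
    define P where "P = (\<Prod>j<s. 2 * a (Suc (Suc j)) + 1)"
    have digits: "(\<Sum>j=0..s. a (Suc j) * m ^ j) = m * p + a 1"
      using sum_digits_shift[of "\<lambda>j. a (Suc j)" m s]
      by (simp add: p_def atLeast0AtMost lessThan_Suc_atMost)
    have digits': "(\<Sum>j=0..Suc s. a j * m ^ j) = m * (m * p + a 1) + a 0"
      using sum_digits_shift[of a m "Suc s"] digits
      by (simp add: atLeast0AtMost lessThan_Suc_atMost del: sum.lessThan_Suc sum.atMost_Suc)
    have R: "[bbar m (m * (m * p + a 1)) = R] (mod m\<^sup>2)"
      using Suc.IH[of "\<lambda>j. a (Suc j)"] Suc.prems unfolding digits R_def by simp
    \<comment> \<open>Modulo \<open>m\<close> suffices here, since this term enters with the factor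
      \<open>2 * m\<close>.\<close>
    have "[bbar m (m * p) = P] (mod m)"
      unfolding p_def P_def using Suc.prems by (intro bbar_mult_cong_prod assms(1)) simp
    then have "[(a 1)\<^sup>2 * bbar m (m * p) = (a 1)\<^sup>2 * P] (mod m)"
      by (rule cong_scalar_left)
    then have "[m * ((a 1)\<^sup>2 * bbar m (m * p)) = m * ((a 1)\<^sup>2 * P)] (mod m\<^sup>2)"
      unfolding power2_eq_square[of m] by (rule cong_cmult_leftI)
    then have P: "[2 * m * ((a 1)\<^sup>2 * bbar m (m * p)) = 2 * m * ((a 1)\<^sup>2 * P)] (mod m\<^sup>2)"
      unfolding mult.assoc by (rule cong_scalar_left)
    have "[bbar m (m * (m * (m * p + a 1) + a 0)) =
      (2 * a 0 + 1) * bbar m (m * (m * p + a 1)) + 2 * m * ((a 1)\<^sup>2 * bbar m (m * p))] (mod m\<^sup>2)"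
      (is "[_ = ?expansion] (mod _)")
      using Suc.prems by (intro bbar_mult_two_digits_cong assms(1)) simp_all
    also have "[?expansion = (2 * a 0 + 1) * R + 2 * m * ((a 1)\<^sup>2 * P)] (mod m\<^sup>2)"
      by (intro cong_add cong_scalar_left R P)
    also have "(2 * a 0 + 1) * R + 2 * m * ((a 1)\<^sup>2 * P) = (\<Prod>i=0..Suc s. 2 * a i + 1) +
      2 * m * (\<Sum>i=1..Suc s. (a i)\<^sup>2 * (\<Prod>j\<in>{0..Suc s} - {i, i - 1}. 2 * a j + 1))"
      unfolding sum_prod_adjacent_shift R_def P_def prod.atLeast0_atMost_Suc_shift
      by (simp add: algebra_simps)
    finally show ?case
      unfolding digits' .
  qed
qed

end
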